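(* Let $G$ be a finite, simple, connected $(n,k,\lambda,\mu)$-strongly regular graph that is neither complete nor complete bipartite, and let $\eta=\frac{kn}{\gcd(2(n-1),kn)}$. For an edge $uv$ let $E_{uv}\in\mathcal{K}(G)$ be the class of $\mathbf{e}_u-\mathbf{e}_v$. Suppose $u_1v_1,\dots,u_rv_r$ ($r\geq1$) are edges of $G$ such that, with $E_i:=E_{u_iv_i}$, $\langle E_i,E_j\rangle=0$ in $\mathbb{Q}/\mathbb{Z}$ for all $i\neq j$. Then $\mathcal{K}(G)$ contains a subgroup isomorphic to $\mathbb{Z}/n\mu\mathbb{Z}\oplus(\mathbb{Z}/\eta\mathbb{Z})^{r-1}$.
   Context: An $(n,k,\lambda,\mu)$-strongly regular graph is a $k$-regular graph on $n$ vertices in which any two adjacent vertices have exactly $\lambda$ common neighbors and any two non-adjacent vertices have exactly $\mu$ common neighbors. $\mathbf{e}_1,\dots,\mathbf{e}_n$ is the standard basis of $\mathbb{Z}^n$. The Laplacian is $L=D-A$ and the critical group is $\mathcal{K}(G)=\{\mathbf{u}\in\mathbb{Z}^n:\sum_i\mathbf{u}_i=0\}/\operatorname{row}_{\mathbb{Z}}L$. The monodromy pairing $\langle\cdot,\cdot\rangle:\mathcal{K}(G)\times\mathcal{K}(G)\to\mathbb{Q}/\mathbb{Z}$: for $\mathbf{D},\mathbf{D}'$ with coordinate sum $0$, choose positive integers $m,m'$ and $\mathbf{f},\mathbf{f}'\in\mathbb{Z}^n$ with $L\mathbf{f}=m\mathbf{D}$, $L\mathbf{f}'=m'\mathbf{D}'$;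 then $\langle[\mathbf{D}],[\mathbf{D}']\rangle=\frac{\mathbf{f}^T\mathbf{D}'}{m}=\frac{\mathbf{D}^T\mathbf{f}'}{m'}\bmod\mathbb{Z}$ (well defined, bilinear, symmetric). *)

theory Defs
  imports "HOL-Analysis.Analysis" "HOL-Algebra.Product_Groups" "HOL-Algebra.Elementary_Groups" "Graph_Theory.Graph_Theory"
begin

text \<open>
  Finite simple graphs are the symmetric, loop-free, finite digraphs of the locale
  \<open>pair_graph\<close>; an undirected edge \<open>uv\<close> is present as the two arcs \<open>(u, v)\<close> and \<open>(v, u)\<close>.
  The constructions on \<open>\<int>\<^sup>n\<close> index coordinates by a finite type \<open>'v\<close>, which is meant to be
  the whole vertex set: \<open>pverts G = UNIV\<close> and \<open>n = CARD('v)\<close>.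
\<close>

definition nbrs :: "'v pair_pre_digraph \<Rightarrow> 'v \<Rightarrow> 'v set" where
  "nbrs G u = {w. (u, w) \<in> parcs G}"

definition strongly_regular :: "'v pair_pre_digraph \<Rightarrow> nat \<Rightarrow> nat \<Rightarrow> nat \<Rightarrow> nat \<Rightarrow> bool" where
  "strongly_regular G n k lam mu \<longleftrightarrow>
     pair_graph G \<and> card (pverts G) = n \<and>
     (\<forall>u \<in> pverts G. card (nbrs G u) = k) \<and>
     (\<forall>u \<in> pverts G. \<forall>v \<in> pverts G.
        (u, v) \<in> parcs G \<longrightarrow> card (nbrs G u \<inter> nbrs G v) = lam) \<and>
     (\<forall>u \<in> pverts G. \<forall>v \<in> pverts G.
        u \<noteq> v \<and> (u, v) \<notin> parcs G \<longrightarrow> card (nbrs G u \<inter> nbrs G v) = mu)"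

definition degree_matrix :: "('v::finite) pair_pre_digraph \<Rightarrow> int^'v^'v" where
  "degree_matrix G = (\<chi> i j. if i = j then int (card (nbrs G i)) else 0)"

definition adjacency_matrix :: "('v::finite) pair_pre_digraph \<Rightarrow> int^'v^'v" where
  "adjacency_matrix G = (\<chi> i j. if (i, j) \<in> parcs G then 1 else 0)"

definition laplacian :: "('v::finite) pair_pre_digraph \<Rightarrow> int^'v^'v" where
  "laplacian G = degree_matrix G - adjacency_matrix G"

definition sum_zero_group :: "(int^'v::finite) monoid" where
  "sum_zero_group = \<lparr>carrier = {x. (\<Sum>i\<in>UNIV. x $ i) = 0}, monoid.mult = (+), one = 0\<rparr>"

definition row_lattice :: "int^'v::finite^'m::finite \<Rightarrow> (int^'v) set" where
  "row_lattice M = range (\<lambda>x. x v* M)"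

definition critical_group :: "('v::finite) pair_pre_digraph \<Rightarrow> (int^'v) set monoid" where
  "critical_group G = sum_zero_group Mod row_lattice (laplacian G)"

definition div_class :: "('v::finite) pair_pre_digraph \<Rightarrow> int^'v \<Rightarrow> (int^'v) set" where
  "div_class G D = row_lattice (laplacian G) #>\<^bsub>sum_zero_group\<^esub> D"

definition edge_class :: "('v::finite) pair_pre_digraph \<Rightarrow> 'v \<Rightarrow> 'v \<Rightarrow> (int^'v) set" where
  "edge_class G u v = div_class G (axis u 1 - axis v 1)"

definition rat_group :: "rat monoid" where
  "rat_group = \<lparr>carrier = UNIV, monoid.mult = (+), one = 0\<rparr>"

definition rat_mod_int :: "rat set monoid" where
  "rat_mod_int = rat_group Mod \<int>"

text \<open>
  The value of the monodromy pairing is the residue class modulo \<open>\<int>\<close> of \<open>f\<^sup>T D' / m\<close>, for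
  any representatives \<open>D\<close>, \<open>D'\<close> of the two classes and any \<open>m > 0\<close> and \<open>f\<close> with \<open>L f = m D\<close>.
  For connected \<open>G\<close> the class exists and does not depend on these choices, so that the
  definite description denotes it.
\<close>

definition monodromy_pairing ::
    "('v::finite) pair_pre_digraph \<Rightarrow> (int^'v) set \<Rightarrow> (int^'v) set \<Rightarrow> rat set" where
  "monodromy_pairing G X Y =
     (THE q. \<exists>D \<in> X. \<exists>D' \<in> Y. \<exists>(m::int) f. m > 0 \<and> laplacian G *v f = m *s D \<and>
        q = \<int> #>\<^bsub>rat_group\<^esub> (of_int (\<Sum>i\<in>UNIV. f $ i * D' $ i) / of_int m))"

end

theory Submission
  imports Defs
begin

text \<open>
  Write \<open>N = n \<mu>\<close> and \<open>P = (2 k - \<lambda> + \<mu>) I - L\<close>.  Strong regularity gives \<open>L P = P L = N I - \<mu> J\<close>, so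
  \<open>N\<close> kills the critical group and the pairing of \<open>D\<close> with \<open>D'\<close> is \<open>D' \<cdot> P D / N\<close>.  In particular an
  edge pairs with itself to \<open>2 (n - 1) / (k n)\<close>, which has order \<open>\<eta>\<close>.  As the graph is neither
  complete nor complete bipartite, two entries of \<open>P E\<^sub>1\<close> differ by \<open>1\<close>; hence some class \<open>z\<close> satisfies
  \<open>\<langle>E\<^sub>1, z\<rangle> = 1 / N\<close>, so that \<open>E\<^sub>1\<close> has order \<open>N\<close> and \<open>\<langle>E\<^sub>1\<rangle>\<close> is complemented by \<open>z\<^sup>\<bottom>\<close>.  Let
  \<open>x\<^sub>i\<close> be the projection of \<open>E\<^sub>i\<close> to \<open>z\<^sup>\<bottom>\<close>, for \<open>i > 1\<close>.  Pairing with the \<open>E\<^sub>j\<close> shows that the lattice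
  \<open>R\<close> of relations among the \<open>x\<^sub>i\<close> lies in \<open>\<eta> \<int>\<^sup>r\<^sup>-\<^sup>1\<close>.  It has full rank, and the \<open>\<eta>\<close>-torsion of
  \<open>\<int>\<^sup>r\<^sup>-\<^sup>1 / R\<close> is \<open>\<eta>\<^sup>-\<^sup>1 R / R\<close>, which is isomorphic to \<open>(\<int> / \<eta>)\<^sup>r\<^sup>-\<^sup>1\<close>.
\<close>

section \<open>Subgroups of the integer lattice\<close>

definition int_dot :: "int^'v \<Rightarrow> int^'v \<Rightarrow> int" where
  "int_dot x y = (\<Sum>i\<in>UNIV. x $ i * y $ i)"

definition coord_sum :: "int^'v \<Rightarrow> int" where
  "coord_sum x = (\<Sum>i\<in>UNIV. x $ i)"

lemma int_dot_linear:
  "int_dot (x + y) z = int_dot x z + int_dot y z" "int_dot z (x + y) = int_dot z x + int_dot z y"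
  "int_dot (x - y) z = int_dot x z - int_dot y z" "int_dot z (x - y) = int_dot z x - int_dot z y"
  "int_dot (c *s x) z = c * int_dot x z" "int_dot z (c *s x) = c * int_dot z x"
  by (simp_all add: int_dot_def algebra_simps sum.distrib sum_subtractf sum_distrib_left)

lemma int_dot_commute: "int_dot x y = int_dot y x"
  by (simp add: int_dot_def mult.commute)

lemma int_dot_axis: "int_dot (axis i 1) y = (y :: int^'v::finite) $ i"
proof -
  have "int_dot (axis i 1) y = (\<Sum>j\<in>UNIV. if j = i then y $ j else 0)"
    unfolding int_dot_def by (intro sum.cong) (auto simp: axis_def)
  then show ?thesis by simp
qed

lemma coord_sum_linear:
  "coord_sum (x + y) = coord_sum x + coord_sum y" "coord_sum (x - y) = coord_sum x - coord_sum y"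
  "coord_sum (c *s x) = c * coord_sum x" "coord_sum 0 = 0"
  by (simp_all add: coord_sum_def sum.distrib sum_subtractf sum_distrib_left)

lemma coord_sum_axis: "coord_sum (axis i 1 :: int^'v::finite) = 1"
  by (simp add: coord_sum_def axis_def)

text \<open>Stated for bare sets of vectors, so that lattice arguments can use \<open>+\<close> and
  \<open>*s\<close>; \<open>int_subgroup_imp_subgroup\<close> later converts to subgroups of
  \<open>sum_zero_group\<close>.\<close>

definition int_subgroup :: "(int^'v) set \<Rightarrow> bool" where
  "int_subgroup A \<longleftrightarrow> 0 \<in> A \<and> (\<forall>x\<in>A. \<forall>y\<in>A. x - y \<in> A)"

lemma int_subgroup_0: "int_subgroup A \<Longrightarrow> 0 \<in> A"
  and int_subgroup_diff: "int_subgroup A \<Longrightarrow> x \<in> A \<Longrightarrow> y \<in> A \<Longrightarrow> x - y \<in> A"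
  by (auto simp: int_subgroup_def)

lemma int_subgroup_uminus: "int_subgroup A \<Longrightarrow> x \<in> A \<Longrightarrow> - x \<in> A"
  using int_subgroup_diff[of A 0 x] int_subgroup_0 by auto

lemma int_subgroup_add: "int_subgroup A \<Longrightarrow> x \<in> A \<Longrightarrow> y \<in> A \<Longrightarrow> x + y \<in> A"
  using int_subgroup_diff[of A x "- y"] int_subgroup_uminus by auto

lemma int_subgroup_scale:
  assumes "int_subgroup A" "x \<in> A"
  shows "c *s x \<in> A"
proof -
  have nat: "int m *s x \<in> A" for m
    by (induction m) (auto simp: vector_sadd_rdistrib int_subgroup_0 int_subgroup_add assms)
  show ?thesis
  proof (cases "c \<ge> 0")
    case True
    then show ?thesis using nat[of "nat c"] by simp
  next
    case False
    then have "c *s x = - (int (nat (- c)) *s x)" by (simp add: vec_eq_iff)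
    then show ?thesis using nat[of "nat (- c)"] int_subgroup_uminus assms by metis
  qed
qed

lemma int_subgroup_sum:
  assumes "int_subgroup A" "\<And>i. i \<in> I \<Longrightarrow> f i \<in> A"
  shows "sum f I \<in> A"
  using assms(2) by (induction I rule: infinite_finite_induct)
    (auto simp: int_subgroup_0 int_subgroup_add assms(1))

section \<open>Integer combinations and the relations among them\<close>

definition int_comb :: "nat \<Rightarrow> (nat \<Rightarrow> int) \<Rightarrow> (nat \<Rightarrow> int^'v) \<Rightarrow> int^'v" where
  "int_comb s c x = (\<Sum>i<s. c i *s x i)"

lemma int_comb_diff: "int_comb s (\<lambda>i. c i - d i) x = int_comb s c x - int_comb s d x"
  by (simp add: int_comb_def vec_eq_iff sum_subtractf algebra_simps)

lemma int_comb_scale: "int_comb s (\<lambda>i. a * c i) x = a *s int_comb s c x"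
  by (simp add: int_comb_def vec_eq_iff sum_distrib_left algebra_simps)

lemma int_subgroup_range_int_comb: "int_subgroup (range (\<lambda>c. int_comb s c x))"
proof -
  have "int_comb s (\<lambda>i. 0) x = 0" by (simp add: int_comb_def vec_eq_iff)
  then have "0 \<in> range (\<lambda>c. int_comb s c x)" by (metis rangeI)
  moreover have "int_comb s c x - int_comb s d x \<in> range (\<lambda>c. int_comb s c x)" for c d
    using rangeI[of "\<lambda>c. int_comb s c x" "\<lambda>i. c i - d i"] by (simp add: int_comb_diff)
  ultimately show ?thesis unfolding int_subgroup_def by blast
qed

lemma range_int_comb_Suc: "range (\<lambda>c. int_comb s c x) \<subseteq> range (\<lambda>c. int_comb (Suc s) c x)"
proof clarify
  fix c
  have "int_comb s c x = int_comb (Suc s) (c(s := 0)) x"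
    by (simp add: int_comb_def vec_eq_iff)
  then show "int_comb s c x \<in> range (\<lambda>c. int_comb (Suc s) c x)" by (metis rangeI)
qed

text \<open>
  The relations among \<open>x 0, \<dots>, x (s - 1)\<close> modulo \<open>A\<close> form a sublattice of \<open>\<eta> \<int>\<^sup>s\<close> of full rank.
  The \<open>y j\<close> are the members of a triangular basis of that lattice, divided by \<open>\<eta>\<close>.
\<close>

lemma free_mod_combinations_exist:
  fixes A :: "(int^'v) set" and N \<eta> :: int
  assumes "int_subgroup A" and "N > 0" and "\<eta> > 0"
    and "\<And>i. i < s \<Longrightarrow> N *s x i \<in> A"
    and "\<And>c i. int_comb s c x \<in> A \<Longrightarrow> i < s \<Longrightarrow> \<eta> dvd c i"
  shows "\<exists>y. (\<forall>j<s. y j \<in> range (\<lambda>c. int_comb s c x)) \<and>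
    (\<forall>c. int_comb s c y \<in> A \<longleftrightarrow> (\<forall>j<s. \<eta> dvd c j))"
  using assms(4,5)
proof (induction s)
  case 0
  then show ?case by (simp add: int_comb_def assms(1) int_subgroup_0)
next
  case (Suc s)
  \<comment> \<open>A relation among the first \<open>s\<close> vectors extends by the coefficient 0
    at \<open>s\<close>.\<close>
  have dvd_s: "\<eta> dvd c i" if "int_comb s c x \<in> A" "i < s" for c i
  proof -
    have "int_comb (Suc s) (c(s := 0)) x = int_comb s c x"
      by (simp add: int_comb_def vec_eq_iff)
    then show ?thesis using Suc.prems(2)[of "c(s := 0)" i] that
      by (metis fun_upd_other less_SucI less_irrefl)
  qed
  have "\<exists>y. (\<forall>j<s. y j \<in> range (\<lambda>c. int_comb s c x)) \<and>
    (\<forall>c. int_comb s c y \<in> A \<longleftrightarrow> (\<forall>j<s. \<eta> dvd c j))"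
    by (rule Suc.IH) (simp_all add: Suc.prems(1) dvd_s)
  then obtain y
    where y: "\<And>j. j < s \<Longrightarrow> y j \<in> range (\<lambda>c. int_comb s c x)"
      "\<And>c. int_comb s c y \<in> A \<longleftrightarrow> (\<forall>j<s. \<eta> dvd c j)"
    by auto
  \<comment> \<open>The last coefficients of relations form an ideal of the integers. It contains
    \<open>N\<close>, so it is nonzero, and its least positive member \<open>d\<close> generates
    it.\<close>
  define P where "P = (\<lambda>d::nat. d > 0 \<and> (\<exists>c. c s = int d \<and> int_comb (Suc s) c x \<in> A))"
  define d where "d = (LEAST d. P d)"
  have "int_comb (Suc s) ((\<lambda>_. 0)(s := N)) x = N *s x s"
    by (simp add: int_comb_def vec_eq_iff)
  then have "P (nat N)"
    unfolding P_def using assms(2) Suc.prems(1)[of s]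
    by (intro conjI exI[of _ "(\<lambda>_. 0)(s := N)"]) auto
  then have "P d" unfolding d_def by (rule LeastI)
  then obtain r where d: "d > 0" and r: "r s = int d" "int_comb (Suc s) r x \<in> A"
    unfolding P_def by auto
  have dvd_d: "int d dvd c s" if c: "int_comb (Suc s) c x \<in> A" for c
  proof (rule ccontr)
    assume "\<not> int d dvd c s"
    then have "c s mod int d \<noteq> 0" by (simp add: dvd_eq_mod_eq_0)
    moreover have "c s mod int d \<ge> 0" using d by simp
    ultimately have nz: "c s mod int d > 0" by linarith
    \<comment> \<open>Euclidean division: subtracting a multiple of \<open>r\<close> leaves a
      relation whose last coefficient is the remainder, against the minimality of
      \<open>d\<close>.\<close>
    define c' where "c' = (\<lambda>i. c i - (c s div int d) * r i)"
    have "int_comb (Suc s) c' x \<in> A"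
      unfolding c'_def int_comb_diff int_comb_scale
      by (intro int_subgroup_diff int_subgroup_scale assms(1) c r)
    moreover have "c' s = int (nat (c s mod int d))"
      using nz unfolding c'_def r(1) by (metis minus_div_mult_eq_mod int_nat_eq order_less_imp_le)
    ultimately have "P (nat (c s mod int d))"
      using nz unfolding P_def by auto
    then have "d \<le> nat (c s mod int d)" unfolding d_def by (rule Least_le)
    moreover have "c s mod int d < int d" using d by simp
    ultimately show False using nz by linarith
  qed
  \<comment> \<open>All coefficients of \<open>r\<close> are multiples of \<eta>. Dividing them by
    \<eta> gives the new vector: an integral combination of the \<open>x i\<close> whose
    \<eta>-multiple lies in \<open>A\<close>.\<close>
  define q where "q = (\<lambda>i. r i div \<eta>)"
  have rq: "r i = \<eta> * q i" if "i < Suc s" for i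
    using Suc.prems(2)[OF r(2) that] by (simp add: q_def)
  define y' where "y' = y(s := int_comb (Suc s) q x)"
  have "\<eta> *s int_comb (Suc s) q x = int_comb (Suc s) r x"
    unfolding int_comb_scale[symmetric] by (simp add: int_comb_def rq del: sum.lessThan_Suc)
  then have eta_y': "\<eta> *s y' s \<in> A" using r by (simp add: y'_def)
  have comb_y': "int_comb (Suc s) c y' = int_comb s c y + c s *s y' s" for c
    by (simp add: int_comb_def y'_def)
  have in_range: "y' j \<in> range (\<lambda>c. int_comb (Suc s) c x)" if "j < Suc s" for j
    using that y(1)[of j] range_int_comb_Suc[of s x] by (auto simp: y'_def)
  have iff: "int_comb (Suc s) c y' \<in> A \<longleftrightarrow> (\<forall>j<Suc s. \<eta> dvd c j)" for c
  proof -
    have eta_cs: "c s *s y' s \<in> A" if "\<eta> dvd c s"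
    proof -
      have "c s *s y' s = (c s div \<eta>) *s (\<eta> *s y' s)" using that by (simp add: vec_eq_iff)
      then show ?thesis using eta_y' int_subgroup_scale assms(1) by metis
    qed
    have "\<eta> dvd c s" if c: "int_comb (Suc s) c y' \<in> A"
    proof -
      have "int_comb s c y \<in> range (\<lambda>c. int_comb s c x)"
        unfolding int_comb_def[of s c y]
        by (intro int_subgroup_sum int_subgroup_scale int_subgroup_range_int_comb y) auto
      then obtain b where b: "int_comb s c y = int_comb s b x" by auto
      \<comment> \<open>Rewritten in the \<open>x i\<close>, the relation has last coefficient
        \<open>c s * q s\<close>. This is a multiple of \<open>int d = \<eta> * q s\<close>, and
        \<open>q s\<close> cancels.\<close>
      define b' where "b' = (\<lambda>i. (if i < s then b i else 0) + c s * q i)"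
      have "int_comb (Suc s) c y' = int_comb (Suc s) b' x"
        unfolding comb_y' b by (simp add: y'_def int_comb_def b'_def vec_eq_iff algebra_simps
            sum.distrib sum_distrib_left)
      then have "int d dvd b' s" using c dvd_d by metis
      then have "\<eta> * q s dvd c s * q s" using rq[of s] r by (simp add: b'_def)
      moreover have "q s \<noteq> 0" using rq[of s] r d by auto
      ultimately show ?thesis by simp
    qed
    then show ?thesis
      using eta_cs y(2)[of c] comb_y'[of c] int_subgroup_diff[OF assms(1), of "int_comb (Suc s) c y'" "c s *s y' s"]
        int_subgroup_add[OF assms(1), of "int_comb s c y" "c s *s y' s"]
      by (auto simp: less_Suc_eq)
  qed
  show ?case using in_range iff by blast
qed

lemma int_matrix_vector_linear:
  "M *v (x - y) = M *v x - M *v y" "M *v (c *s x) = c *s (M *v x)" for M :: "int^'v::finite^'m"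
  by (simp_all add: matrix_vector_mult_def vec_eq_iff sum_subtractf algebra_simps sum_distrib_left)

text \<open>Cancelling the gcd leaves coprime factors. For positive \<open>b\<close>, the number
  \<open>b div gcd a b\<close> is the order of the fraction \<open>a / b\<close> modulo the
  integers, which is how \<eta> arises.\<close>

lemma dvd_mult_imp_div_gcd_dvd:
  fixes a b c :: int
  assumes "b dvd a * c" "b \<noteq> 0"
  shows "b div gcd a b dvd c"
proof -
  have g: "gcd a b \<noteq> 0" using assms by simp
  have "gcd a b * (b div gcd a b) dvd gcd a b * ((a div gcd a b) * c)"
    using assms by (simp add: mult.assoc[symmetric])
  then have "b div gcd a b dvd (a div gcd a b) * c"
    using g by (metis dvd_mult_cancel_left)
  moreover have "coprime (b div gcd a b) (a div gcd a b)"
    using div_gcd_coprime[of b a] assms by (simp add: gcd.commute)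
  ultimately show ?thesis by (simp add: coprime_dvd_mult_right_iff)
qed

section \<open>Subgroups of quotients\<close>

lemma sum_zero_group_simps [simp]:
  "carrier sum_zero_group = {x. coord_sum x = 0}"
  "x \<otimes>\<^bsub>sum_zero_group\<^esub> y = x + y"
  "\<one>\<^bsub>sum_zero_group\<^esub> = 0"
  by (simp_all add: sum_zero_group_def coord_sum_def)

lemma comm_group_sum_zero_group: "comm_group (sum_zero_group :: (int^'v::finite) monoid)"
proof (rule comm_groupI)
  fix x :: "int^'v" assume "x \<in> carrier sum_zero_group"
  then have "- x \<in> carrier sum_zero_group"
    by (simp add: coord_sum_def sum_negf)
  then show "\<exists>y\<in>carrier sum_zero_group. y \<otimes>\<^bsub>sum_zero_group\<^esub> x = \<one>\<^bsub>sum_zero_group\<^esub>"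
    by (intro bexI[of _ "- x"]) simp
qed (simp_all add: coord_sum_linear algebra_simps)

lemma r_coset_sum_zero_group: "A #>\<^bsub>sum_zero_group\<^esub> x = {a + x | a. a \<in> A}"
  by (auto simp: r_coset_def)

lemma int_subgroup_imp_subgroup:
  assumes "int_subgroup A" "\<And>x. x \<in> A \<Longrightarrow> coord_sum x = 0"
  shows "subgroup A (sum_zero_group :: (int^'v::finite) monoid)"
proof -
  interpret comm_group "sum_zero_group :: (int^'v) monoid"
    by (rule comm_group_sum_zero_group)
  show ?thesis
  proof (rule subgroupI)
    fix a assume a: "a \<in> A"
    have "inv\<^bsub>sum_zero_group\<^esub> a = - a"
      using assms int_subgroup_uminus[of A a] a by (intro inv_equality) auto
    then show "inv\<^bsub>sum_zero_group\<^esub> a \<in> A"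
      using assms int_subgroup_uminus a by metis
  qed (use assms in \<open>auto simp: int_subgroup_add intro: int_subgroup_0\<close>)
qed

lemma r_coset_eq_iff:
  assumes "int_subgroup A"
  shows "A #>\<^bsub>sum_zero_group\<^esub> x = A #>\<^bsub>sum_zero_group\<^esub> y \<longleftrightarrow> x - y \<in> A"
proof
  assume "A #>\<^bsub>sum_zero_group\<^esub> x = A #>\<^bsub>sum_zero_group\<^esub> y"
  moreover have "x \<in> A #>\<^bsub>sum_zero_group\<^esub> x"
    using int_subgroup_0[OF assms] by (force simp: r_coset_sum_zero_group)
  ultimately obtain a where "a \<in> A" "x = a + y"
    by (auto simp: r_coset_sum_zero_group)
  then show "x - y \<in> A" by simp
next
  assume xy: "x - y \<in> A"
  have "a + x = (a + (x - y)) + y" "a + y = (a - (x - y)) + x" for a by simp_all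
  moreover have "a + (x - y) \<in> A" "a - (x - y) \<in> A" if "a \<in> A" for a
    using that xy assms int_subgroup_add int_subgroup_diff by blast+
  ultimately show "A #>\<^bsub>sum_zero_group\<^esub> x = A #>\<^bsub>sum_zero_group\<^esub> y"
    unfolding r_coset_sum_zero_group by blast
qed

text \<open>By \<open>iff\<close>, the coefficient vectors giving the trivial class are exactly
  those divisible by \<open>N\<close> and \<eta> respectively. One direction makes the map
  \<open>h\<close> respect the reductions in the cyclic groups, the other makes it injective;
  \<open>H\<close> is its image.\<close>

lemma subgroup_iso_product_exists:
  fixes A :: "(int^'v::finite) set" and e :: "int^'v" and y :: "nat \<Rightarrow> int^'v"
  assumes A: "int_subgroup A" "\<And>x. x \<in> A \<Longrightarrow> coord_sum x = 0"
    and pos: "N > 0" "\<eta> > 0"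
    and sums: "coord_sum e = 0" "\<And>j. j < s \<Longrightarrow> coord_sum (y j) = 0"
    and iff: "\<And>c0 c. c0 *s e + int_comb s c y \<in> A \<longleftrightarrow>
      int N dvd c0 \<and> (\<forall>j<s. int \<eta> dvd c j)"
  shows "\<exists>H. subgroup H (sum_zero_group Mod A) \<and>
           (sum_zero_group Mod A)\<lparr>carrier := H\<rparr> \<cong>
             integer_mod_group N \<times>\<times> product_group {..<s} (\<lambda>_. integer_mod_group \<eta>)"
proof -
  let ?P = "integer_mod_group N \<times>\<times> product_group {..<s} (\<lambda>_. integer_mod_group \<eta>)"
  let ?K = "sum_zero_group Mod A"
  interpret S: comm_group "sum_zero_group :: (int^'v) monoid"
    by (rule comm_group_sum_zero_group)
  have norm: "A \<lhd> sum_zero_group"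
    by (rule S.subgroup_imp_normal) (rule int_subgroup_imp_subgroup[OF A])
  interpret K: group ?K by (rule normal.factorgroup_is_group[OF norm])
  interpret P: group ?P by (intro DirProd_group product_group) simp_all
  define g where "g = (\<lambda>p. fst p *s e + int_comb s (snd p) y)"
  define h where "h = (\<lambda>p. A #>\<^bsub>sum_zero_group\<^esub> g p)"
  have g_sum: "coord_sum (g p) = 0" for p
  proof -
    have "coord_sum (int_comb s (snd p) y) = 0"
      unfolding int_comb_def using sums(2)
      by (induction s) (simp_all add: coord_sum_linear)
    then show ?thesis by (simp add: g_def coord_sum_linear sums)
  qed
  have g_diff: "g p - g q = (fst p - fst q) *s e + int_comb s (\<lambda>j. snd p j - snd q j) y" for p q
    by (simp add: g_def int_comb_diff vec_eq_iff algebra_simps)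
  have h_eq_iff: "h p = h q \<longleftrightarrow> int N dvd fst p - fst q \<and> (\<forall>j<s. int \<eta> dvd snd p j - snd q j)" for p q
    unfolding h_def r_coset_eq_iff[OF A(1)] g_diff iff ..
  have hom: "h \<in> hom ?P ?K"
  proof (rule homI)
    fix p assume "p \<in> carrier ?P"
    show "h p \<in> carrier ?K"
      using g_sum by (auto simp: carrier_FactGroup h_def)
  next
    fix p q assume "p \<in> carrier ?P" "q \<in> carrier ?P"
    have g_add: "g p + g q = g (fst p + fst q, \<lambda>j. snd p j + snd q j)"
      by (simp add: g_def int_comb_def vec_eq_iff sum.distrib algebra_simps)
    \<comment> \<open>Multiplication in the product reduces the coordinates modulo \<open>N\<close>
      and \<eta>; \<open>h\<close> takes the same value on the unreduced sums.\<close>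
    have "h (p \<otimes>\<^bsub>?P\<^esub> q) = h (fst p + fst q, \<lambda>j. snd p j + snd q j)"
      unfolding h_eq_iff
      by (cases p; cases q) (auto simp: DirProd_def mod_eq_dvd_iff[symmetric])
    also have "\<dots> = h p \<otimes>\<^bsub>?K\<^esub> h q"
      using normal.rcos_sum[OF norm, of "g p" "g q"] g_sum by (simp add: h_def g_add)
    finally show "h (p \<otimes>\<^bsub>?P\<^esub> q) = h p \<otimes>\<^bsub>?K\<^esub> h q" .
  qed
  have inj: "inj_on h (carrier ?P)"
  proof (rule inj_onI)
    fix p q assume p: "p \<in> carrier ?P" and q: "q \<in> carrier ?P" and "h p = h q"
    then have N: "int N dvd fst p - fst q" and \<eta>: "\<And>j. j < s \<Longrightarrow> int \<eta> dvd snd p j - snd q j"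
      by (auto simp: h_eq_iff)
    \<comment> \<open>Elements of the cyclic groups are least nonnegative residues, so congruent
      ones coincide.\<close>
    have small: "a = b" if "int m dvd a - b" "a \<in> carrier (integer_mod_group m)"
        "b \<in> carrier (integer_mod_group m)" "m > 0" for m and a b :: int
      using that by (auto simp: carrier_integer_mod_group mod_eq_dvd_iff[symmetric])
    have "fst p = fst q"
      using small[OF N _ _ pos(1)] p q by (simp add: DirProd_def mem_Times_iff)
    \<comment> \<open>Members of the product group are extensional, so agreement below
      \<open>s\<close> suffices.\<close>
    moreover have "snd p = snd q"
    proof (rule PiE_ext)
      show "snd p \<in> (\<Pi>\<^sub>E j\<in>{..<s}. carrier (integer_mod_group \<eta>))"
        "snd q \<in> (\<Pi>\<^sub>E j\<in>{..<s}. carrier (integer_mod_group \<eta>))"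
        using p q by (simp_all add: DirProd_def mem_Times_iff)
      then show "snd p j = snd q j" if "j \<in> {..<s}" for j
        using that by (intro small[OF \<eta> _ _ pos(2)]) (blast dest: PiE_mem)+
    qed
    ultimately show "p = q" by (rule prod_eqI)
  qed
  interpret h: group_hom ?P ?K h by unfold_locales (rule hom)
  let ?H = "h ` carrier ?P"
  have "h \<in> iso ?P (?K\<lparr>carrier := ?H\<rparr>)"
    using hom inj by (auto simp: iso_def bij_betw_def hom_def)
  then have "?P \<cong> ?K\<lparr>carrier := ?H\<rparr>" by (auto simp: is_iso_def)
  then show ?thesis
    using h.img_is_subgroup P.iso_sym by blast
qed

section \<open>Residue classes of rationals modulo the integers\<close>

lemma r_coset_rat_group: "\<int> #>\<^bsub>rat_group\<^esub> a = {z + a | z. z \<in> \<int>}"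
  by (auto simp: r_coset_def rat_group_def)

lemma rat_coset_eq_iff: "\<int> #>\<^bsub>rat_group\<^esub> a = \<int> #>\<^bsub>rat_group\<^esub> b \<longleftrightarrow> a - b \<in> \<int>"
proof
  assume eq: "\<int> #>\<^bsub>rat_group\<^esub> a = \<int> #>\<^bsub>rat_group\<^esub> b"
  have "a \<in> \<int> #>\<^bsub>rat_group\<^esub> a" by (force simp: r_coset_rat_group)
  then have "a \<in> \<int> #>\<^bsub>rat_group\<^esub> b" by (simp only: eq)
  then show "a - b \<in> \<int>" by (auto simp: r_coset_rat_group)
next
  assume ab: "a - b \<in> \<int>"
  have "z + a = (z + (a - b)) + b" "z + b = (z - (a - b)) + a" for z by simp_all
  moreover have "z + (a - b) \<in> \<int>" "z - (a - b) \<in> \<int>" if "z \<in> \<int>" for z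
    using that ab by (blast intro: Ints_add Ints_diff)+
  ultimately show "\<int> #>\<^bsub>rat_group\<^esub> a = \<int> #>\<^bsub>rat_group\<^esub> b"
    unfolding r_coset_rat_group by blast
qed

lemma rat_quotient_diff_Ints:
  assumes "int m dvd a - b" "m > 0"
  shows "(of_int a / of_int (int m) :: rat) - of_int b / of_int (int m) \<in> \<int>"
proof -
  obtain q where "a - b = int m * q" using assms(1) by blast
  then have "(of_int a :: rat) - of_int b = of_int (int m) * of_int q"
    by (metis of_int_diff of_int_mult)
  then have "(of_int a / of_int (int m) :: rat) - of_int b / of_int (int m) = of_int q"
    using assms(2) by (simp add: field_simps)
  then show ?thesis by simp
qed

section \<open>Strongly regular graphs\<close>

locale srg =
  fixes G :: "('v::finite) pair_pre_digraph" and n k lam mu :: nat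
  assumes vertices: "pverts G = UNIV"
    and srg: "strongly_regular G n k lam mu"
begin

abbreviation "A \<equiv> adjacency_matrix G"
abbreviation "L \<equiv> laplacian G"
abbreviation "\<Lambda> \<equiv> row_lattice L"

text \<open>On vectors of coordinate sum zero, \<open>pot\<close> inverts the Laplacian up to the factor \<open>n \<mu>\<close>.\<close>

definition pot :: "int^'v \<Rightarrow> int^'v" where
  "pot x = (2 * int k - int lam + int mu) *s x - L *v x"

section \<open>The adjacency matrix and its quadratic equation\<close>

lemma arc_sym: "(i, j) \<in> parcs G \<longleftrightarrow> (j, i) \<in> parcs G"
proof -
  interpret pair_graph G using srg by (simp add: strongly_regular_def)
  show ?thesis using pair_sym_arcs by (auto simp: symmetric_def dest: symD)
qed

lemma no_loop: "(i, i) \<notin> parcs G"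
proof -
  interpret pair_graph G using srg by (simp add: strongly_regular_def)
  show ?thesis using pair_no_loops[of "(i, i)"] by auto
qed

lemma n_eq: "n = CARD('v)"
  using srg vertices by (simp add: strongly_regular_def)

lemma n_pos: "n > 0"
  by (simp add: n_eq)

lemma card_nbrs: "card (nbrs G i) = k"
  using srg vertices by (simp add: strongly_regular_def)

lemma A_nth: "A $ i $ j = (if (i, j) \<in> parcs G then 1 else 0)"
  by (simp add: adjacency_matrix_def)

lemma A_sym: "A $ i $ j = A $ j $ i"
  by (simp add: A_nth arc_sym[of i j])

lemma sum_A: "(\<Sum>j\<in>UNIV. A $ i $ j) = int k"
proof -
  have "{j. (i, j) \<in> parcs G} = nbrs G i" by (simp add: nbrs_def)
  then show ?thesis by (simp add: A_nth sum.If_cases card_nbrs)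
qed

lemma L_mult: "L *v x = int k *s x - A *v x"
proof -
  have "degree_matrix G *v x = int k *s x"
    by (simp add: vec_eq_iff matrix_vector_mult_def degree_matrix_def card_nbrs if_distrib
        [where f = "\<lambda>t. t * _"] cong: if_cong)
  then show ?thesis by (simp add: laplacian_def matrix_vector_mult_diff_rdistrib)
qed

lemma pot_eq: "pot x = (int k - int lam + int mu) *s x + A *v x"
  by (simp add: pot_def L_mult vec_eq_iff algebra_simps)

text \<open>The left side counts walks of length two, that is, common neighbors of \<open>i\<close>
  and \<open>j\<close>; there are \<open>k\<close>, \<open>lam\<close> or \<open>mu\<close> of them
  according to whether the vertices are equal, adjacent, or neither.\<close>

lemma A_square_nth:
  "(\<Sum>w\<in>UNIV. A $ i $ w * A $ w $ j) =
     (int k - int mu) * (if i = j then 1 else 0) + (int lam - int mu) * A $ i $ j + int mu"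
proof -
  have "(\<Sum>w\<in>UNIV. A $ i $ w * A $ w $ j)
      = (\<Sum>w\<in>UNIV. if w \<in> nbrs G i \<inter> nbrs G j then 1 else 0)"
    by (intro sum.cong) (auto simp: A_nth nbrs_def arc_sym)
  also have "\<dots> = int (card (nbrs G i \<inter> nbrs G j))"
    by (simp add: sum.If_cases Int_def)
  also have "\<dots> = (int k - int mu) * (if i = j then 1 else 0) + (int lam - int mu) * A $ i $ j + int mu"
  proof -
    consider "i = j" | "(i, j) \<in> parcs G" | "i \<noteq> j" "(i, j) \<notin> parcs G" by blast
    then show ?thesis
    proof cases
      case 1
      then show ?thesis by (simp add: A_nth no_loop card_nbrs)
    next
      case 2
      moreover from 2 have "i \<noteq> j" using no_loop by auto
      moreover have "card (nbrs G i \<inter> nbrs G j) = lam"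
        using 2 srg vertices by (auto simp: strongly_regular_def)
      ultimately show ?thesis by (simp add: A_nth)
    next
      case 3
      moreover have "card (nbrs G i \<inter> nbrs G j) = mu"
        using 3 srg vertices by (auto simp: strongly_regular_def)
      ultimately show ?thesis by (simp add: A_nth)
    qed
  qed
  finally show ?thesis .
qed

lemma A_square:
  "A *v (A *v x) = (int k - int mu) *s x + (int lam - int mu) *s (A *v x)
     + (int mu * coord_sum x) *s 1"
proof -
  have "(A *v (A *v x)) $ i = (((int k - int mu) *s x + (int lam - int mu) *s (A *v x)
     + (int mu * coord_sum x) *s 1)) $ i" for i
  proof -
    have "(A *v (A *v x)) $ i = (\<Sum>w\<in>UNIV. \<Sum>j\<in>UNIV. A $ i $ w * A $ w $ j * x $ j)"
      by (simp add: matrix_vector_mult_def sum_distrib_left mult.assoc)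
    also have "\<dots> = (\<Sum>j\<in>UNIV. (\<Sum>w\<in>UNIV. A $ i $ w * A $ w $ j) * x $ j)"
      by (subst sum.swap) (simp add: sum_distrib_right)
    also have "\<dots> = (\<Sum>j\<in>UNIV. (int k - int mu) * (if i = j then x $ j else 0)
        + (int lam - int mu) * (A $ i $ j * x $ j) + int mu * x $ j)"
      unfolding A_square_nth by (intro sum.cong) (auto simp: algebra_simps)
    also have "\<dots> = (int k - int mu) * x $ i + (int lam - int mu) * (A *v x) $ i + int mu * coord_sum x"
      by (simp add: sum.distrib sum_distrib_left[symmetric] coord_sum_def matrix_vector_mult_def)
    finally show ?thesis
      by (simp only: vector_add_component vector_smult_component one_index mult_1_right)
  qed
  then show ?thesis by (simp only: vec_eq_iff) blast
qed

lemma A_one: "A *v 1 = int k *s 1"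
  by (simp add: vec_eq_iff matrix_vector_mult_def sum_A)

text \<open>The all-ones vector is an eigenvector of \<open>A\<close> for \<open>k\<close>, and the
  quadratic equation is evaluated on it.\<close>

lemma parameter_identity: "int k * (int k - int lam - 1 + int mu) = (int n - 1) * int mu"
proof -
  have "coord_sum (1 :: int^'v) = int n" by (simp add: coord_sum_def n_eq)
  then have "int k * int k = int k - int mu + (int lam - int mu) * int k + int mu * int n"
    using A_square[of 1] by (simp add: A_one int_matrix_vector_linear vec_eq_iff)
  then show ?thesis by (simp add: algebra_simps)
qed

section \<open>Symmetry, and inversion of the Laplacian up to a factor\<close>

lemma coord_sum_A: "coord_sum (A *v x) = int k * coord_sum x"
proof -
  have "coord_sum (A *v x) = (\<Sum>j\<in>UNIV. (\<Sum>i\<in>UNIV. A $ j $ i) * x $ j)"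
    unfolding coord_sum_def matrix_vector_mult_def
    by (simp, subst sum.swap, simp add: sum_distrib_right A_sym)
  then show ?thesis by (simp add: sum_A coord_sum_def sum_distrib_left)
qed

lemma coord_sum_L: "coord_sum (L *v x) = 0"
  by (simp add: L_mult coord_sum_linear coord_sum_A)

lemma int_dot_A: "int_dot x (A *v y) = int_dot y (A *v x)"
proof -
  have "int_dot x (A *v y) = (\<Sum>i\<in>UNIV. \<Sum>j\<in>UNIV. A $ i $ j * x $ i * y $ j)"
    by (simp add: int_dot_def matrix_vector_mult_def sum_distrib_left mult_ac)
  also have "\<dots> = (\<Sum>j\<in>UNIV. \<Sum>i\<in>UNIV. A $ j $ i * x $ i * y $ j)"
    by (subst sum.swap) (simp add: A_sym)
  also have "\<dots> = int_dot y (A *v x)"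
    by (simp add: int_dot_def matrix_vector_mult_def sum_distrib_left mult_ac)
  finally show ?thesis .
qed

lemma int_dot_pot: "int_dot x (pot y) = int_dot y (pot x)"
  by (simp add: pot_eq int_dot_linear int_dot_A[of x y] int_dot_commute[of x y])

lemma pot_linear: "pot (x - y) = pot x - pot y" "pot (x + y) = pot x + pot y" "pot (c *s x) = c *s pot x"
  by (simp_all add: pot_eq int_matrix_vector_linear matrix_vector_right_distrib vec_eq_iff algebra_simps)

text \<open>After \<open>A_square\<close> eliminates the second power of \<open>A\<close>, the terms
  in \<open>A *v x\<close> cancel, and \<open>parameter_identity\<close> turns the coefficient of
  \<open>x\<close> into \<open>n * mu\<close>.\<close>

lemma L_pot: "L *v pot x = int (n * mu) *s x - (int mu * coord_sum x) *s 1"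
proof -
  have id: "int k * int k - int k * int lam + int mu * int k = int n * int mu - int mu + int k"
    using parameter_identity by (simp add: algebra_simps)
  let ?c = "int k - int lam + int mu"
  have "L *v pot x = (int k * ?c) *s x + (int k - ?c) *s (A *v x) - A *v (A *v x)"
    by (simp add: pot_eq L_mult int_matrix_vector_linear matrix_vector_right_distrib vec_eq_iff algebra_simps)
  also have "\<dots> = (int k * ?c - int k + int mu) *s x - (int mu * coord_sum x) *s 1"
    unfolding A_square by (simp add: vec_eq_iff algebra_simps)
  also have "int k * ?c - int k + int mu = int (n * mu)"
    using id by (simp add: algebra_simps)
  finally show ?thesis .
qed

text \<open>As a polynomial in \<open>L\<close>, the map \<open>pot\<close> commutes with
  \<open>L\<close>.\<close>

lemma pot_L: "pot (L *v x) = int (n * mu) *s x - (int mu * coord_sum x) *s 1"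
  unfolding L_pot[symmetric] by (simp only: pot_def int_matrix_vector_linear)

section \<open>The row lattice and the monodromy pairing\<close>

lemma row_lattice_eq: "\<Lambda> = range (\<lambda>x. L *v x)"
proof -
  have "L $ i $ j = L $ j $ i" for i j
    using A_sym[of i j] by (simp add: laplacian_def degree_matrix_def)
  then have "x v* L = L *v x" for x
    by (simp add: vec_eq_iff vector_matrix_mult_def matrix_vector_mult_def mult.commute)
  then show ?thesis by (simp add: row_lattice_def)
qed

lemma int_subgroup_row_lattice: "int_subgroup \<Lambda>"
  unfolding int_subgroup_def row_lattice_eq
  by (auto simp: int_matrix_vector_linear[symmetric] intro: image_eqI[of _ _ 0])

lemma coord_sum_row_lattice: "x \<in> \<Lambda> \<Longrightarrow> coord_sum x = 0"
  by (auto simp: row_lattice_eq coord_sum_L)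

lemma scaled_in_row_lattice:
  assumes "coord_sum x = 0"
  shows "int (n * mu) *s x \<in> \<Lambda>"
  using L_pot[of x] assms by (auto simp: row_lattice_eq intro: image_eqI[of _ _ "pot x"])

text \<open>On \<open>L *v t\<close>, \<open>pot\<close> gives \<open>n * mu\<close> times
  \<open>t\<close> up to a constant vector, which \<open>z\<close> annihilates. Hence
  \<open>int_dot z (pot x)\<close> modulo \<open>n * mu\<close> depends only on the class of
  \<open>x\<close>.\<close>

lemma row_lattice_dvd:
  assumes "x \<in> \<Lambda>" "coord_sum z = 0"
  shows "int (n * mu) dvd int_dot z (pot x)"
proof -
  obtain t where "x = L *v t" using assms(1) by (auto simp: row_lattice_eq)
  moreover have "int_dot z 1 = 0" using assms(2) by (simp add: int_dot_def coord_sum_def)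
  ultimately show ?thesis by (simp add: pot_L int_dot_linear)
qed

lemma div_class_eq: "div_class G D = {l + D | l. l \<in> \<Lambda>}"
  by (simp add: div_class_def r_coset_sum_zero_group)

text \<open>The choice \<open>m = n * mu\<close>, \<open>f = pot D\<close> is admissible. Any other
  choice gives the same residue, as applying \<open>pot\<close> to its defining equation
  shows.\<close>

lemma monodromy_pairing_eq:
  assumes "coord_sum D = 0" "coord_sum D' = 0" and mu: "mu > 0"
  shows "monodromy_pairing G (div_class G D) (div_class G D') =
    \<int> #>\<^bsub>rat_group\<^esub> (of_int (int_dot D' (pot D)) / of_int (int (n * mu)))"
  unfolding monodromy_pairing_def
proof (rule the_equality)
  have "D \<in> div_class G D" "D' \<in> div_class G D'"
    using int_subgroup_0[OF int_subgroup_row_lattice] by (force simp: div_class_eq)+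
  moreover have "L *v pot D = int (n * mu) *s D" using assms by (simp add: L_pot)
  moreover have "int (n * mu) > 0" using mu n_pos by simp
  moreover have "int_dot D' (pot D) = (\<Sum>i\<in>UNIV. pot D $ i * D' $ i)"
    by (simp add: int_dot_def mult.commute)
  ultimately show "\<exists>d\<in>div_class G D. \<exists>d'\<in>div_class G D'. \<exists>m f. 0 < m \<and> L *v f = m *s d \<and>
      \<int> #>\<^bsub>rat_group\<^esub> (of_int (int_dot D' (pot D)) / of_int (int (n * mu)))
      = \<int> #>\<^bsub>rat_group\<^esub> (of_int (\<Sum>i\<in>UNIV. f $ i * d' $ i) / of_int m)"
    by (intro bexI[of _ D] bexI[of _ D'] exI[of _ "int (n * mu)"] exI[of _ "pot D"])
      (simp_all only: simp_thms)
next
  fix q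
  assume "\<exists>d\<in>div_class G D. \<exists>d'\<in>div_class G D'. \<exists>m f. 0 < m \<and> L *v f = m *s d \<and>
      q = \<int> #>\<^bsub>rat_group\<^esub> (of_int (\<Sum>i\<in>UNIV. f $ i * d' $ i) / of_int m)"
  then obtain l l' m f where l: "l \<in> \<Lambda>" and l': "l' \<in> \<Lambda>" and m: "m > 0"
    and f: "L *v f = m *s (l + D)"
    and q: "q = \<int> #>\<^bsub>rat_group\<^esub> (of_int (int_dot f (l' + D')) / of_int m)"
    by (auto simp: div_class_eq int_dot_def)
  have "coord_sum (l' + D') = 0"
    using assms l' by (simp add: coord_sum_linear coord_sum_row_lattice)
  then have one: "int_dot (l' + D') 1 = 0" by (simp add: int_dot_def coord_sum_def)
  \<comment> \<open>Here \<open>f\<close> is recovered from \<open>L *v f\<close> up to a constant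
    vector, which is orthogonal to \<open>l' + D'\<close>.\<close>
  have "int_dot (l' + D') (pot (L *v f)) = int (n * mu) * int_dot (l' + D') f"
    unfolding pot_L int_dot_linear(4,6) one by simp
  then have scaled: "m * int_dot (l' + D') (pot (l + D)) = int (n * mu) * int_dot f (l' + D')"
    by (simp only: f pot_linear int_dot_linear int_dot_commute[of f])
  have "(of_int m :: rat) * of_int (int_dot (l' + D') (pot (l + D)))
      = of_int (int (n * mu)) * of_int (int_dot f (l' + D'))"
    unfolding of_int_mult[symmetric] scaled ..
  moreover have "(of_int (int (n * mu)) :: rat) \<noteq> 0" "(of_int m :: rat) \<noteq> 0"
    using mu n_pos m by auto
  ultimately have quot: "(of_int (int_dot f (l' + D')) / of_int m :: rat)
      = of_int (int_dot (l' + D') (pot (l + D))) / of_int (int (n * mu))"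
    by (metis frac_eq_eq mult.commute)
  \<comment> \<open>These are the cross terms caused by changing representatives; the middle one
    needs the symmetry of \<open>pot\<close>.\<close>
  have "int (n * mu) dvd int_dot l' (pot l)" "int (n * mu) dvd int_dot l' (pot D)"
    "int (n * mu) dvd int_dot D' (pot l)"
    using row_lattice_dvd[OF l] row_lattice_dvd[OF l'] l' assms
    by (simp_all add: coord_sum_row_lattice int_dot_pot[of l' D])
  then have "int (n * mu) dvd int_dot (l' + D') (pot (l + D)) - int_dot D' (pot D)"
    by (simp add: pot_linear int_dot_linear)
  then show "q = \<int> #>\<^bsub>rat_group\<^esub> (of_int (int_dot D' (pot D)) / of_int (int (n * mu)))"
    unfolding q quot rat_coset_eq_iff
    using mu n_pos by (intro rat_quotient_diff_Ints) simp_all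
qed

text \<open>Orthogonality enters the main argument only as this divisibility of integers.\<close>

lemma dvd_if_monodromy_pairing_trivial:
  assumes "coord_sum D = 0" "coord_sum D' = 0" and mu: "mu > 0"
    and "monodromy_pairing G (div_class G D) (div_class G D') = \<one>\<^bsub>rat_mod_int\<^esub>"
  shows "int (n * mu) dvd int_dot D' (pot D)"
proof -
  have "\<one>\<^bsub>rat_mod_int\<^esub> = \<int> #>\<^bsub>rat_group\<^esub> 0"
    by (auto simp: rat_mod_int_def r_coset_rat_group)
  then have "(of_int (int_dot D' (pot D)) / of_int (int (n * mu)) :: rat) \<in> \<int>"
    using assms monodromy_pairing_eq[of D D'] rat_coset_eq_iff[of _ 0] by simp
  then obtain z where "(of_int (int_dot D' (pot D)) / of_int (int (n * mu)) :: rat) = of_int z"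
    by (auto elim: Ints_cases)
  then have "(of_int (int_dot D' (pot D)) :: rat) = of_int (int (n * mu) * z)"
    using mu n_pos by (simp add: field_simps)
  then have "int_dot D' (pot D) = int (n * mu) * z" by (simp only: of_int_eq_iff)
  then show ?thesis by simp
qed

section \<open>Connectedness and inequalities for the parameters\<close>

lemma connected_closed_set:
  assumes conn: "Digraph_Component.connected (with_proj G)" and "a \<in> C"
    and closed: "\<And>x y. x \<in> C \<Longrightarrow> (x, y) \<in> parcs G \<Longrightarrow> y \<in> C"
  shows "b \<in> C"
proof -
  let ?S = "with_proj (mk_symmetric (with_proj G))"
  \<comment> \<open>Connectedness refers to the symmetric closure, which adds no arcs to a symmetric
    graph.\<close>
  have arcs: "(x, y) \<in> parcs G" if "(x, y) \<in> arcs_ends ?S" for x y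
    using that arc_sym by (auto simp: mk_symmetric_def)
  have "a \<rightarrow>\<^sup>*\<^bsub>?S\<^esub> b"
    using conn vertices by (simp add: connected_def strongly_connected_def mk_symmetric_def)
  then have "(a, b) \<in> rtrancl_on (verts ?S) (arcs_ends ?S)"
    unfolding reachable_def .
  then show ?thesis
    by (induction rule: rtrancl_on_induct) (use \<open>a \<in> C\<close> closed arcs in blast)+
qed

text \<open>Otherwise the neighbors of \<open>a\<close> other than \<open>b\<close> are neighbors of
  \<open>b\<close>, for every edge \<open>ab\<close>. Then each closed neighborhood is closed under
  arcs, hence is everything, and the graph is complete.\<close>

lemma lam_less:
  assumes conn: "Digraph_Component.connected (with_proj G)"
    and not_complete: "\<not> complete_digraph n (with_proj G)"
    and k: "k > 0"
  shows "lam + 1 < k"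
proof (rule ccontr)
  assume "\<not> lam + 1 < k"
  then have lam: "k - 1 \<le> lam" by simp
  have sub: "nbrs G a - {b} \<subseteq> nbrs G b" if "(a, b) \<in> parcs G" for a b
  proof -
    have "card (nbrs G a \<inter> nbrs G b) = lam"
      using that srg vertices by (auto simp: strongly_regular_def)
    moreover have "card (nbrs G a - {b}) = k - 1"
      using that card_nbrs[of a] by (subst card_Diff_singleton) (simp_all add: nbrs_def)
    moreover have "nbrs G a \<inter> nbrs G b \<subseteq> nbrs G a - {b}"
      using no_loop by (auto simp: nbrs_def)
    ultimately have "nbrs G a \<inter> nbrs G b = nbrs G a - {b}"
      using lam by (intro card_seteq) auto
    then show ?thesis by blast
  qed
  have "(a, b) \<in> parcs G" if "a \<noteq> b" for a b
  proof -
    have "b \<in> insert a (nbrs G a)"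
    proof (rule connected_closed_set[OF conn, of a])
      fix x y assume x: "x \<in> insert a (nbrs G a)" and xy: "(x, y) \<in> parcs G"
      show "y \<in> insert a (nbrs G a)"
      proof (cases "x = a")
        case False
        then have "(x, a) \<in> parcs G" using x arc_sym by (auto simp: nbrs_def)
        then show ?thesis using sub xy by (auto simp: nbrs_def)
      qed (use xy in \<open>auto simp: nbrs_def\<close>)
    qed simp
    then show ?thesis using that by (auto simp: nbrs_def)
  qed
  then have "parcs G = {(a, b). (a, b) \<in> pverts G \<times> pverts G \<and> a \<noteq> b}"
    using no_loop vertices by auto
  then show False
    using not_complete n_eq vertices by (simp add: complete_digraph_pair_def)
qed

text \<open>For \<open>mu = 0\<close>, \<open>parameter_identity\<close> would read
  \<open>k * (k - lam - 1) = 0\<close>.\<close>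

lemma mu_pos: "lam + 1 < k \<Longrightarrow> mu > 0"
  using parameter_identity by (cases "mu = 0") auto

section \<open>Pairings of edge classes\<close>

definition edge_vec :: "'v \<Rightarrow> 'v \<Rightarrow> int^'v" where
  "edge_vec a b = axis a 1 - axis b 1"

lemma coord_sum_edge_vec: "coord_sum (edge_vec a b) = 0"
  by (simp add: edge_vec_def coord_sum_linear coord_sum_axis)

lemma int_dot_edge_vec: "int_dot (edge_vec a b) x = x $ a - x $ b"
  by (simp add: edge_vec_def int_dot_linear int_dot_axis)

lemma pot_edge_vec:
  "pot (edge_vec a b) $ w = (int k - int lam + int mu) *
     ((if w = a then 1 else 0) - (if w = b then 1 else 0)) + A $ w $ a - A $ w $ b"
proof -
  have "(A *v edge_vec a b) $ w = int_dot (edge_vec a b) (A $ w)"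
    by (simp add: matrix_vector_mult_def int_dot_def mult.commute)
  then show ?thesis
    by (simp add: pot_eq int_dot_edge_vec) (simp add: edge_vec_def axis_def)
qed

lemma edge_self_pairing:
  assumes "(a, b) \<in> parcs G"
  shows "int_dot (edge_vec a b) (pot (edge_vec a b)) = 2 * (int k - int lam - 1 + int mu)"
proof -
  have "a \<noteq> b" "(b, a) \<in> parcs G" using assms no_loop arc_sym by auto
  then show ?thesis
    using assms by (simp add: int_dot_edge_vec pot_edge_vec A_nth no_loop)
qed

text \<open>By \<open>parameter_identity\<close>, the self-pairing of an edge divided by
  \<open>n * mu\<close> equals \<open>2 * (n - 1) / (k * n)\<close>. The proof clears denominators:
  it multiplies by \<open>k\<close>, then cancels \<open>mu\<close>.\<close>

lemma dvd_if_dvd_edge_self_pairing: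
  assumes "(a, b) \<in> parcs G" and "mu > 0" and "k > 0"
    and dvd: "int (n * mu) dvd c * int_dot (edge_vec a b) (pot (edge_vec a b))"
  shows "int ((k * n) div gcd (2 * (n - 1)) (k * n)) dvd c"
proof -
  have "int (n - 1) = int n - 1" using n_pos by simp
  then have "int mu * int (2 * (n - 1)) = 2 * ((int n - 1) * int mu)" by simp
  also have "\<dots> = int k * (2 * (int k - int lam - 1 + int mu))"
    unfolding parameter_identity[symmetric] by simp
  finally have "int k * (2 * (int k - int lam - 1 + int mu)) = int mu * int (2 * (n - 1))" ..
  then have t: "int k * (c * (2 * (int k - int lam - 1 + int mu))) = int mu * (int (2 * (n - 1)) * c)"
    by (metis mult.assoc mult.commute)
  have "int mu * int (k * n) dvd int k * (c * (2 * (int k - int lam - 1 + int mu)))"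
    using mult_dvd_mono[OF dvd_refl[of "int k"] dvd] assms(1) by (simp add: edge_self_pairing mult_ac)
  then have "int (k * n) dvd int (2 * (n - 1)) * c"
    unfolding t using assms(2) by simp
  then have "int (k * n) div gcd (int (2 * (n - 1))) (int (k * n)) dvd c"
    by (rule dvd_mult_imp_div_gcd_dvd) (use assms(3) n_pos in simp)
  then show ?thesis by (simp only: gcd_int_int_eq zdiv_int)
qed

text \<open>Away from \<open>a\<close> and \<open>b\<close>, the potential is 1 at vertices adjacent
  to \<open>a\<close> only and 0 at vertices adjacent to both or neither. Both kinds occur: the
  first since \<open>lam + 1 < k\<close>, the second since the graph is not complete
  bipartite.\<close>

lemma edge_pot_unit_difference:
  assumes edge: "(a, b) \<in> parcs G" and lam: "lam + 1 < k"
    and nb: "\<not> (\<exists>p q. complete_bipartite_digraph p q (with_proj G))"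
  shows "\<exists>w w'. pot (edge_vec a b) $ w - pot (edge_vec a b) $ w' = 1"
proof -
  have ab: "a \<noteq> b" "(b, a) \<in> parcs G" using edge no_loop arc_sym by auto
  have lam_eq: "card (nbrs G x \<inter> nbrs G y) = lam" if "(x, y) \<in> parcs G" for x y
    using that srg vertices by (auto simp: strongly_regular_def)
  have "\<exists>w. w \<in> nbrs G a \<and> w \<noteq> b \<and> w \<notin> nbrs G b"
  proof (rule ccontr)
    assume "\<not> ?thesis"
    then have "nbrs G a \<subseteq> insert b (nbrs G a \<inter> nbrs G b)" by blast
    then have "k \<le> card (insert b (nbrs G a \<inter> nbrs G b))"
      using card_mono[of "insert b (nbrs G a \<inter> nbrs G b)" "nbrs G a"] by (simp add: card_nbrs)
    also have "\<dots> \<le> Suc lam" using lam_eq[OF edge] by (simp add: card_insert_if)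
    finally show False using lam by simp
  qed
  then obtain w where w: "(a, w) \<in> parcs G" "w \<noteq> b" "(b, w) \<notin> parcs G"
    by (auto simp: nbrs_def)
  then have "w \<noteq> a" using no_loop by auto
  then have w1: "pot (edge_vec a b) $ w = 1"
    using w arc_sym by (auto simp: pot_edge_vec A_nth)
  have "\<exists>w'. w' \<noteq> a \<and> w' \<noteq> b \<and> (w' \<in> nbrs G a \<longleftrightarrow> w' \<in> nbrs G b)"
  proof (rule ccontr)
    assume "\<not> ?thesis"
    \<comment> \<open>The edge \<open>ab\<close> makes this true of \<open>a\<close> and
      \<open>b\<close> too, so the two neighborhoods partition the vertex set.\<close>
    then have *: "x \<in> nbrs G a \<longleftrightarrow> x \<notin> nbrs G b" for x
      using edge ab no_loop by (cases "x = a"; cases "x = b") (auto simp: nbrs_def)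
    then have "nbrs G a \<inter> nbrs G b = {}" by blast
    then have "lam = 0" using lam_eq[OF edge] by simp
    then have triangle_free: "nbrs G x \<inter> nbrs G y = {}" if "(x, y) \<in> parcs G" for x y
      using lam_eq[OF that] by simp
    have indep: "y \<notin> nbrs G z" if "(x, y) \<in> parcs G" "(x, z) \<in> parcs G" for x y z
    proof
      assume "y \<in> nbrs G z"
      moreover have "y \<in> nbrs G x" using that by (simp add: nbrs_def)
      ultimately show False using triangle_free[OF that(2)] by auto
    qed
    \<comment> \<open>Neighbors of \<open>x\<close> cannot be neighbors of \<open>a\<close>, for
      lack of triangles, so they lie in the other part; equal cardinality \<open>k\<close> gives
      equality.\<close>
    have eqb: "nbrs G x = nbrs G b" if "x \<in> nbrs G a" for x
    proof (rule card_subset_eq)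
      show "nbrs G x \<subseteq> nbrs G b"
        using that * indep[of a _ x] by (auto simp: nbrs_def)
    qed (simp_all add: card_nbrs)
    have eqa: "nbrs G x = nbrs G a" if "x \<in> nbrs G b" for x
    proof (rule card_subset_eq)
      show "nbrs G x \<subseteq> nbrs G a"
        using that * indep[of b _ x] by (auto simp: nbrs_def)
    qed (simp_all add: card_nbrs)
    have "parcs G = nbrs G a \<times> nbrs G b \<union> nbrs G b \<times> nbrs G a"
    proof (rule Set.set_eqI)
      fix p :: "'v \<times> 'v"
      obtain x y where p: "p = (x, y)" by (cases p)
      have "(x, y) \<in> parcs G \<longleftrightarrow> y \<in> nbrs G x" by (simp add: nbrs_def)
      also have "\<dots> \<longleftrightarrow> p \<in> nbrs G a \<times> nbrs G b \<union> nbrs G b \<times> nbrs G a"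
        using eqa[of x] eqb[of x] *[of x] by (cases "x \<in> nbrs G a") (auto simp: p)
      finally show "p \<in> parcs G \<longleftrightarrow> p \<in> nbrs G a \<times> nbrs G b \<union> nbrs G b \<times> nbrs G a"
        by (simp add: p)
    qed
    moreover have "pverts G = nbrs G a \<union> nbrs G b" "nbrs G a \<inter> nbrs G b = {}"
      using * vertices by auto
    ultimately have "complete_bipartite_digraph (card (nbrs G a)) (card (nbrs G b)) (with_proj G)"
      unfolding complete_bipartite_digraph_pair_def by (intro conjI exI[of _ "nbrs G a"] exI[of _ "nbrs G b"]) simp_all
    then show False using nb by blast
  qed
  then obtain w' where "w' \<noteq> a" "w' \<noteq> b" "w' \<in> nbrs G a \<longleftrightarrow> w' \<in> nbrs G b" by blast
  then have "pot (edge_vec a b) $ w' = 0"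
    using arc_sym by (auto simp: pot_edge_vec A_nth nbrs_def)
  then show ?thesis using w1 by (intro exI[of _ w] exI[of _ w']) simp
qed

lemma int_dot_pot_int_comb:
  "int_dot z (pot (int_comb s c x)) = (\<Sum>j<s. c j * int_dot z (pot (x j)))"
proof (induction s)
  case 0
  have "pot 0 = 0" using pot_linear(1)[of 0 0] by simp
  then show ?case by (simp add: int_comb_def int_dot_def)
next
  case (Suc s)
  have "int_comb (Suc s) c x = int_comb s c x + c s *s x s" by (simp add: int_comb_def)
  then show ?case by (simp add: pot_linear int_dot_linear Suc)
qed

end

section \<open>Splitting off one edge and assembling the subgroup\<close>

theorem theorem4p5:
  fixes G :: "('v::finite) pair_pre_digraph"
    and n k lam mu eta r :: nat
    and u v :: "nat \<Rightarrow> 'v"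
  assumes vertices: "pverts G = UNIV"
    and srg: "strongly_regular G n k lam mu"
    and conn: "Digraph_Component.connected (with_proj G)"
    and not_complete: "\<not> complete_digraph n (with_proj G)"
    and not_complete_bipartite: "\<not> (\<exists>a b. complete_bipartite_digraph a b (with_proj G))"
    and eta: "eta = (k * n) div gcd (2 * (n - 1)) (k * n)"
    and r: "r \<ge> 1"
    and edges: "\<And>i. i < r \<Longrightarrow> (u i, v i) \<in> parcs G"
    and orthogonal: "\<And>i j. i < r \<Longrightarrow> j < r \<Longrightarrow> i \<noteq> j \<Longrightarrow>
          monodromy_pairing G (edge_class G (u i) (v i)) (edge_class G (u j) (v j))
            = \<one>\<^bsub>rat_mod_int\<^esub>"
  shows "\<exists>H. subgroup H (critical_group G) \<and>
           (critical_group G)\<lparr>carrier := H\<rparr> \<cong>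
             integer_mod_group (n * mu) \<times>\<times> product_group {..<r - 1} (\<lambda>_. integer_mod_group eta)"
proof -
  interpret srg G n k lam mu by unfold_locales (rule vertices, rule srg)
  define E where "E = (\<lambda>i. edge_vec (u i) (v i))"
  define s where "s = r - 1"
  define N where "N = n * mu"
  have edge0: "(u 0, v 0) \<in> parcs G" using edges r by simp
  have "v 0 \<in> nbrs G (u 0)" using edge0 by (simp add: nbrs_def)
  then have k: "k > 0" using card_nbrs[of "u 0"] card_gt_0_iff[of "nbrs G (u 0)"] by auto
  have lam: "lam + 1 < k" by (rule lam_less[OF conn not_complete k])
  have mu: "mu > 0" by (rule mu_pos[OF lam])
  have N_pos: "N > 0" using mu n_pos by (simp add: N_def)
  have eta_pos: "eta > 0"
    unfolding eta using k n_pos by (intro div_greater_zero_iff[THEN iffD2]) (simp add: gcd_le2_nat)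
  have E_sum: "coord_sum (E i) = 0" for i
    by (simp add: E_def coord_sum_edge_vec)
  have orth: "int N dvd int_dot (E i) (pot (E j))" if "i < r" "j < r" "i \<noteq> j" for i j
    using orthogonal[OF that(2,1)] that E_sum mu unfolding N_def
    by (intro dvd_if_monodromy_pairing_trivial)
      (simp_all add: E_def edge_class_def edge_vec_def)
  obtain w w' where ww': "pot (E 0) $ w - pot (E 0) $ w' = 1"
    using edge_pot_unit_difference[OF edge0 lam not_complete_bipartite] by (auto simp: E_def)
  \<comment> \<open>Pairing with \<open>z\<close> splits the cyclic group generated by the class of \<open>E 0\<close> off.\<close>
  define z where "z = edge_vec w w'"
  define \<psi> where "\<psi> = (\<lambda>x. int_dot z (pot x))"
  have psi_0: "\<psi> (E 0) = 1" using ww' by (simp add: \<psi>_def z_def int_dot_edge_vec)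
  \<comment> \<open>As \<psi> is 1 on \<open>E 0\<close>, this is the projection along
    \<open>E 0\<close> to the kernel of \<psi>. The indices shift by one, leaving
    \<open>s = r - 1\<close> vectors.\<close>
  define x where "x = (\<lambda>i. E (Suc i) - \<psi> (E (Suc i)) *s E 0)"
  have x_sum: "coord_sum (x i) = 0" for i
    by (simp add: x_def coord_sum_linear E_sum)
  have psi_x: "\<psi> (x i) = 0" for i
    using psi_0 by (simp add: x_def \<psi>_def pot_linear int_dot_linear)
  \<comment> \<open>A relation is paired with \<open>E (Suc i)\<close>. Orthogonality to
    \<open>E 0\<close> makes the projection harmless modulo \<open>N\<close>, and orthogonality to
    the other edges leaves \<open>c i\<close> times a self-pairing.\<close>
  have relations: "int eta dvd c i" if c: "int_comb s c x \<in> \<Lambda>" and i: "i < s" for c i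
  proof -
    have ir: "Suc i < r" using i by (simp add: s_def)
    have x_E: "int_dot (E (Suc i)) (pot (x j)) = int_dot (E (Suc i)) (pot (E (Suc j)))
        - \<psi> (E (Suc j)) * int_dot (E (Suc i)) (pot (E 0))" for j
      by (simp add: x_def pot_linear int_dot_linear)
    have "int N dvd int_dot (E (Suc i)) (pot (E 0))" using ir by (intro orth) auto
    then have off: "int N dvd int_dot (E (Suc i)) (pot (x j))" if "j < s" "j \<noteq> i" for j
      unfolding x_E using that ir by (intro dvd_diff dvd_mult orth) (auto simp: s_def)
    have diag: "int N dvd int_dot (E (Suc i)) (pot (x i)) - int_dot (E (Suc i)) (pot (E (Suc i)))"
      using \<open>int N dvd int_dot (E (Suc i)) (pot (E 0))\<close> by (simp add: x_E)
    have "int N dvd (\<Sum>j<s. c j * int_dot (E (Suc i)) (pot (x j)))"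
      using row_lattice_dvd[OF c E_sum[of "Suc i"]] by (simp add: int_dot_pot_int_comb N_def)
    also have "(\<Sum>j<s. c j * int_dot (E (Suc i)) (pot (x j))) = c i * int_dot (E (Suc i)) (pot (x i))
        + (\<Sum>j\<in>{..<s} - {i}. c j * int_dot (E (Suc i)) (pot (x j)))"
      using i by (subst sum.remove[of _ i]) auto
    finally have "int N dvd c i * int_dot (E (Suc i)) (pot (x i))"
      by (subst (asm) dvd_add_left_iff) (auto intro!: dvd_sum dvd_mult intro: off)
    then have "int N dvd c i * int_dot (E (Suc i)) (pot (x i))
        - c i * (int_dot (E (Suc i)) (pot (x i)) - int_dot (E (Suc i)) (pot (E (Suc i))))"
      using diag by (intro dvd_diff) auto
    then have "int N dvd c i * int_dot (E (Suc i)) (pot (E (Suc i)))"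
      by (simp add: algebra_simps)
    then show ?thesis
      unfolding eta N_def E_def
      by (rule dvd_if_dvd_edge_self_pairing[OF edges[OF ir] mu k])
  qed
  have scaled: "int N *s x i \<in> \<Lambda>" for i
    using scaled_in_row_lattice[OF x_sum] by (simp add: N_def)
  have "\<exists>y. (\<forall>j<s. y j \<in> range (\<lambda>c. int_comb s c x)) \<and>
      (\<forall>c. int_comb s c y \<in> \<Lambda> \<longleftrightarrow> (\<forall>j<s. int eta dvd c j))"
    by (rule free_mod_combinations_exist[OF int_subgroup_row_lattice, of "int N" "int eta"])
      (use N_pos eta_pos scaled relations in auto)
  then obtain y where y: "\<And>j. j < s \<Longrightarrow> y j \<in> range (\<lambda>c. int_comb s c x)"
    and y_iff: "\<And>c. int_comb s c y \<in> \<Lambda> \<longleftrightarrow> (\<forall>j<s. int eta dvd c j)"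
    by auto
  have psi_y: "\<psi> (y j) = 0" if j: "j < s" for j
  proof -
    obtain c where "y j = int_comb s c x" using y[OF j] by auto
    then show ?thesis using psi_x by (simp add: \<psi>_def int_dot_pot_int_comb)
  qed
  have y_sum: "coord_sum (y j) = 0" if j: "j < s" for j
  proof -
    obtain c where c: "y j = int_comb s c x" using y[OF j] by auto
    have "coord_sum (int_comb m c x) = 0" for m
      unfolding int_comb_def by (induction m) (simp_all add: coord_sum_linear x_sum)
    then show ?thesis by (simp add: c)
  qed
  \<comment> \<open>Since \<psi> kills every \<open>y j\<close>, it reads off \<open>c0\<close>, and
    it takes multiples of \<open>N\<close> on \<Lambda>. Once \<open>N\<close> divides
    \<open>c0\<close>, the term in \<open>E 0\<close> lies in \<Lambda> and \<open>y_iff\<close>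
    decides the rest.\<close>
  have iff: "c0 *s E 0 + int_comb s c y \<in> \<Lambda> \<longleftrightarrow> int N dvd c0 \<and> (\<forall>j<s. int eta dvd c j)" for c0 c
  proof -
    have E0: "c0 *s E 0 \<in> \<Lambda>" if "int N dvd c0"
    proof -
      have "c0 *s E 0 = (c0 div int N) *s (int N *s E 0)" using that by (simp add: vec_eq_iff)
      then show ?thesis
        using int_subgroup_scale[OF int_subgroup_row_lattice scaled_in_row_lattice[OF E_sum]]
        by (simp add: N_def)
    qed
    have "int N dvd c0" if "c0 *s E 0 + int_comb s c y \<in> \<Lambda>"
    proof -
      have "\<psi> (int_comb s c y) = 0"
        using psi_y by (simp add: \<psi>_def int_dot_pot_int_comb)
      then have "\<psi> (c0 *s E 0 + int_comb s c y) = c0"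
        using psi_0 by (simp add: \<psi>_def pot_linear int_dot_linear)
      then show ?thesis
        using row_lattice_dvd[OF that, of z] by (simp add: \<psi>_def z_def N_def coord_sum_edge_vec)
    qed
    then show ?thesis
      using E0 y_iff[of c] int_subgroup_add[OF int_subgroup_row_lattice, of "c0 *s E 0" "int_comb s c y"]
        int_subgroup_diff[OF int_subgroup_row_lattice, of "c0 *s E 0 + int_comb s c y" "c0 *s E 0"]
      by auto
  qed
  show ?thesis
    unfolding critical_group_def s_def[symmetric] N_def[symmetric]
    by (rule subgroup_iso_product_exists[OF int_subgroup_row_lattice coord_sum_row_lattice
          N_pos eta_pos E_sum[of 0] y_sum iff])
qed

end
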